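(* A graph $G$ has exactly two distinct power domination roots if and only if $G$ is isomorphic to $G_1\,\dot\cup\cdots\dot\cup\, G_k\,\dot\cup\,\overline{K_r}$ for some $k\ge 1$, $r\ge 0$, with $G_i\simeq P_2$ for $1\le i\le k$. Moreover, if $G$ has exactly two distinct power domination roots, these roots are $0$ and $-2$.
   Context: Graphs are finite and simple with nonempty vertex set; $\overline{K_r}$ is the edgeless graph on $r$ vertices (empty if $r=0$), $P_2$ is the path on 2 vertices, $\dot\cup$ is disjoint union. For $S\subseteq V(G)$, $S$ is a power dominating set if, after coloring $S$, coloring every neighbor of a vertex of $S$, and then repeatedly applying the forcing rule (a colored vertex with exactly one uncolored neighbor colors that neighbor) until no changes occur, all vertices are colored. $\mathcal{P}(G;x)=\sum_{i=1}^{|V(G)|}p(G;i)x^i$, where $p(G;i)$ is the number of power dominating sets of size $i$; a power domination root of $G$ is a complex root of $\mathcal{P}(G;x)$. *)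

theory Defs
  imports
    Complex_Main
    "HOL-Computational_Algebra.Polynomial"
    "Graph_Theory.Pair_Digraph"
    "Graph_Theory.Digraph_Isomorphism"
begin

text \<open>
  Finite simple graphs are the graphs of the locale \<^locale>\<open>pair_graph\<close>: a finite vertex set
  with a symmetric, irreflexive set of arcs, an undirected edge \<open>uv\<close> being the pair of arcs
  \<open>(u, v)\<close>, \<open>(v, u)\<close>. That locale admits the empty graph, so nonemptiness of the vertex set is a
  separate hypothesis.
\<close>

definition nbrs :: "'a pair_pre_digraph \<Rightarrow> 'a \<Rightarrow> 'a set" where
  "nbrs G v = {w. (v, w) \<in> parcs G}"

definition closed_nbrs :: "'a pair_pre_digraph \<Rightarrow> 'a set \<Rightarrow> 'a set" where
  "closed_nbrs G S = S \<union> (\<Union>v\<in>S. nbrs G v)"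

definition force_step :: "'a pair_pre_digraph \<Rightarrow> 'a set \<Rightarrow> 'a set" where
  "force_step G C = C \<union> {w. \<exists>u\<in>C. nbrs G u - C = {w}}"

text \<open>
  One application of \<^const>\<open>force_step\<close> performs all currently possible forces simultaneously.
  The iterates increase, so on a finite graph their union is the set of vertices colored when the
  process stops.
\<close>

definition forcing_closure :: "'a pair_pre_digraph \<Rightarrow> 'a set \<Rightarrow> 'a set" where
  "forcing_closure G C = (\<Union>n. (force_step G ^^ n) C)"

definition power_dominating :: "'a pair_pre_digraph \<Rightarrow> 'a set \<Rightarrow> bool" where
  "power_dominating G S \<longleftrightarrow> S \<subseteq> pverts G \<and> forcing_closure G (closed_nbrs G S) = pverts G"

definition num_power_dominating :: "'a pair_pre_digraph \<Rightarrow> nat \<Rightarrow> nat" where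
  "num_power_dominating G i = card {S. power_dominating G S \<and> card S = i}"

definition power_domination_poly :: "'a pair_pre_digraph \<Rightarrow> complex poly" where
  "power_domination_poly G =
     (\<Sum>i = 1..card (pverts G). monom (of_nat (num_power_dominating G i)) i)"

definition power_domination_roots :: "'a pair_pre_digraph \<Rightarrow> complex set" where
  "power_domination_roots G = {z. poly (power_domination_poly G) z = 0}"

definition edgeless_graph :: "nat \<Rightarrow> nat pair_pre_digraph" where
  "edgeless_graph r = \<lparr>pverts = {..<r}, parcs = {}\<rparr>"

definition path_graph :: "nat \<Rightarrow> nat pair_pre_digraph" where
  "path_graph n =
     \<lparr>pverts = {..<n}, parcs = {(i, j). i < n \<and> j < n \<and> (j = Suc i \<or> i = Suc j)}\<rparr>"

definition graph_sum :: "'a pair_pre_digraph \<Rightarrow> 'b pair_pre_digraph \<Rightarrow> ('a + 'b) pair_pre_digraph"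
    (infixl \<open>\<oplus>\<^sub>G\<close> 65) where
  "G \<oplus>\<^sub>G H =
     \<lparr>pverts = pverts G <+> pverts H,
      parcs = {(Inl u, Inl v) | u v. (u, v) \<in> parcs G} \<union> {(Inr u, Inr v) | u v. (u, v) \<in> parcs H}\<rparr>"

definition graph_family_sum ::
    "'i set \<Rightarrow> ('i \<Rightarrow> 'a pair_pre_digraph) \<Rightarrow> ('i \<times> 'a) pair_pre_digraph" where
  "graph_family_sum I F =
     \<lparr>pverts = (SIGMA i:I. pverts (F i)),
      parcs = {((i, u), (i, v)) | i u v. i \<in> I \<and> (u, v) \<in> parcs (F i)}\<rparr>"

abbreviation graph_iso :: "'a pair_pre_digraph \<Rightarrow> 'b pair_pre_digraph \<Rightarrow> bool"
    (infix \<open>\<simeq>\<^sub>G\<close> 50) where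
  "G \<simeq>\<^sub>G H \<equiv> digraph_iso (with_proj G) (with_proj H)"

end

theory Submission
  imports Defs "HOL-Computational_Algebra.Fundamental_Theorem_Algebra"
begin

text \<open>
  Let \<open>n\<close> be the order of \<open>G\<close> and \<open>q\<close> the number of its isolated vertices. Deleting a vertex \<open>v\<close>
  from the full vertex set leaves a power dominating set iff \<open>v\<close> is not isolated. So if the
  polynomial is \<open>x\<^sup>a (x + s)\<^sup>m\<close> with \<open>s \<noteq> 0\<close>, then \<open>s m = n - q\<close>; as \<open>s\<^sup>m\<close> is a coefficient, hence
  an integer, \<open>s\<close> is a positive integer. The smallest power dominating sets have \<open>a = n - m\<close>
  elements, and \<open>2 a \<le> n + q\<close>, even \<open>2 a < n + q\<close> if some vertex has degree at least 2. Hence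
  \<open>s \<le> 2\<close>. For \<open>s = 1\<close> the isolated vertices alone would be power dominating, so \<open>s = 2\<close> and all
  degrees are at most 1.

  Conversely, if all degrees are at most 1, the power dominating sets are the sets that meet every
  component, and their generating function is a product of factors \<open>x\<close> and \<open>x\<^sup>2 + 2 x\<close>.
\<close>

subsection \<open>Small power dominating sets\<close>

definition isolated_verts :: "'a pair_pre_digraph \<Rightarrow> 'a set" where
  "isolated_verts G = {v \<in> pverts G. nbrs G v = {}}"

section \<open>Coloring, forcing and isolated vertices\<close>

lemma subset_force_step: "C \<subseteq> force_step G C"
  by (auto simp: force_step_def)

lemma forcing_closure_superset: "C \<subseteq> forcing_closure G C"
proof -
  have "(force_step G ^^ 0) C \<subseteq> forcing_closure G C"
    unfolding forcing_closure_def by blast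
  then show ?thesis by simp
qed

lemma force_step_subset_forcing_closure: "force_step G C \<subseteq> forcing_closure G C"
proof -
  have "(force_step G ^^ 1) C \<subseteq> forcing_closure G C"
    unfolding forcing_closure_def by blast
  then show ?thesis by simp
qed

lemma forcing_closure_fixpoint:
  assumes "force_step G C = C"
  shows "forcing_closure G C = C"
proof -
  have "(force_step G ^^ n) C = C" for n
    by (induction n) (simp_all add: assms)
  then show ?thesis by (simp add: forcing_closure_def)
qed

lemma in_closed_nbrs_iff: "v \<in> closed_nbrs G S \<longleftrightarrow> v \<in> S \<or> (\<exists>u\<in>S. v \<in> nbrs G u)"
  by (auto simp: closed_nbrs_def)

context pair_graph
begin

lemma nbrs_sym: "v \<in> nbrs G u \<longleftrightarrow> u \<in> nbrs G v"
  using arcs_symmetric by (auto simp: nbrs_def)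

lemma nbrs_irrefl: "v \<notin> nbrs G v"
  using pair_no_loops[of "(v, v)"] by (auto simp: nbrs_def)

lemma nbrs_subset: "nbrs G v \<subseteq> pverts G"
  by (auto simp: nbrs_def dest: in_arcsD2)

lemma nbrs_outside: "v \<notin> pverts G \<Longrightarrow> nbrs G v = {}"
  by (auto simp: nbrs_def dest: in_arcsD1)

lemma closed_nbrs_subset: "S \<subseteq> pverts G \<Longrightarrow> closed_nbrs G S \<subseteq> pverts G"
  using nbrs_subset by (auto simp: closed_nbrs_def)

lemma forcing_closure_subset:
  assumes "C \<subseteq> pverts G"
  shows "forcing_closure G C \<subseteq> pverts G"
proof -
  have "(force_step G ^^ n) C \<subseteq> pverts G" for n
  proof (induction n)
    case (Suc n)
    then show ?case using nbrs_subset by (fastforce simp: force_step_def)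
  qed (use assms in simp)
  then show ?thesis by (auto simp: forcing_closure_def)
qed

text \<open>A neighbour of the only uncolored vertex forces it.\<close>

lemma power_dominatingI:
  assumes "S \<subseteq> pverts G" and "pverts G - {w} \<subseteq> closed_nbrs G S" and "nbrs G w \<noteq> {}"
  shows "power_dominating G S"
proof -
  let ?C = "closed_nbrs G S"
  have sub: "?C \<subseteq> pverts G" using assms(1) by (rule closed_nbrs_subset)
  have "w \<in> force_step G ?C"
  proof (cases "w \<in> ?C")
    case True
    then show ?thesis using subset_force_step by fast
  next
    case False
    obtain u where u: "u \<in> nbrs G w" using assms(3) by auto
    then have "u \<noteq> w" "u \<in> pverts G" using nbrs_irrefl nbrs_subset by auto
    then have "u \<in> ?C" using assms(2) by auto
    moreover have "nbrs G u - ?C = {w}"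
      using False u assms(2) nbrs_subset nbrs_sym by blast
    ultimately show ?thesis by (auto simp: force_step_def)
  qed
  then have "pverts G \<subseteq> force_step G ?C"
    using assms(2) subset_force_step[of ?C G] by blast
  then have "pverts G \<subseteq> forcing_closure G ?C"
    using force_step_subset_forcing_closure[of G ?C] by blast
  with forcing_closure_subset[OF sub] show ?thesis
    using assms(1) by (auto simp: power_dominating_def)
qed

lemma power_dominating_if_dominating:
  assumes "S \<subseteq> pverts G" and "pverts G \<subseteq> closed_nbrs G S"
  shows "power_dominating G S"
  using assms closed_nbrs_subset[OF assms(1)] forcing_closure_subset[of "closed_nbrs G S"]
    forcing_closure_superset[of "closed_nbrs G S" G]
  by (auto simp: power_dominating_def)

text \<open>Neither domination nor forcing ever colors a vertex that is nobody's neighbor, so such a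
  vertex has to be chosen at the start.\<close>

lemma isolated_verts_subset_power_dominating:
  assumes "power_dominating G S"
  shows "isolated_verts G \<subseteq> S"
proof
  fix v assume v: "v \<in> isolated_verts G"
  then have nv: "v \<notin> nbrs G u" for u
    using nbrs_sym by (auto simp: isolated_verts_def)
  show "v \<in> S"
  proof (rule ccontr)
    assume "v \<notin> S"
    have "v \<notin> (force_step G ^^ n) (closed_nbrs G S)" for n
    proof (induction n)
      case 0
      show ?case using \<open>v \<notin> S\<close> nv by (auto simp: closed_nbrs_def)
    next
      case (Suc n)
      then show ?case using nv by (auto simp: force_step_def)
    qed
    then have "v \<notin> forcing_closure G (closed_nbrs G S)"
      by (auto simp: forcing_closure_def)
    moreover have "v \<in> pverts G" using v by (simp add: isolated_verts_def)
    ultimately show False using assms by (simp add: power_dominating_def)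
  qed
qed

text \<open>Isolated vertices color only themselves: their set is stable under both domination and
  forcing.\<close>

lemma power_dominating_isolated_verts:
  assumes "power_dominating G (isolated_verts G)"
  shows "pverts G = isolated_verts G"
proof -
  have "closed_nbrs G (isolated_verts G) = isolated_verts G"
    by (auto simp: closed_nbrs_def isolated_verts_def)
  moreover have "force_step G (isolated_verts G) = isolated_verts G"
    by (auto simp: force_step_def isolated_verts_def)
  ultimately show ?thesis
    using assms forcing_closure_fixpoint[of G] by (simp add: power_dominating_def)
qed

lemma power_dominating_nonempty:
  assumes "power_dominating G S" and "pverts G \<noteq> {}"
  shows "S \<noteq> {}"
proof
  assume "S = {}"
  then have "isolated_verts G = {}"
    using isolated_verts_subset_power_dominating[OF assms(1)] by simp
  then show False using assms power_dominating_isolated_verts \<open>S = {}\<close> by simp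
qed

section \<open>Upper bounds for the size of a smallest power dominating set\<close>

lemma card_isolated_verts_le: "card (isolated_verts G) \<le> card (pverts G)"
  using pair_finite_verts by (intro card_mono) (auto simp: isolated_verts_def)

text \<open>Ore's argument: the complement of an inclusion-minimal dominating set dominates, too.\<close>

lemma dominating_half:
  assumes "W \<subseteq> pverts G" and "\<And>v. v \<in> W \<Longrightarrow> nbrs G v \<inter> W \<noteq> {}"
  shows "\<exists>S\<subseteq>W. W \<subseteq> closed_nbrs G S \<and> 2 * card S \<le> card W"
proof -
  have fin: "finite W" using assms(1) pair_finite_verts finite_subset by blast
  let ?D = "{S. S \<subseteq> W \<and> W \<subseteq> closed_nbrs G S}"
  have "finite ?D" using fin by simp
  moreover have "W \<in> ?D" by (auto simp: closed_nbrs_def)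
  ultimately have "\<exists>S\<in>?D. S \<subseteq> W \<and> (\<forall>T\<in>?D. T \<subseteq> S \<longrightarrow> S = T)"
    by (rule finite_has_minimal2)
  then obtain S where S: "S \<in> ?D" and min: "\<And>T. T \<in> ?D \<Longrightarrow> T \<subseteq> S \<Longrightarrow> S = T"
    by (elim bexE conjE) simp
  have "v \<in> closed_nbrs G (W - S)" if v: "v \<in> W" for v
  proof (cases "v \<in> S")
    case True
    \<comment> \<open>By minimality of \<open>S\<close>, dropping \<open>v\<close> leaves some
      \<open>x\<close> undominated. If \<open>x = v\<close>, then \<open>v\<close> has no neighbor
      in \<open>S\<close>, so its neighbor in \<open>W\<close> lies in \<open>W - S\<close>.
      Otherwise \<open>x\<close> itself is a neighbor of \<open>v\<close> outside
      \<open>S\<close>.\<close>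
    have "S - {v} \<notin> ?D" using min[of "S - {v}"] True by blast
    then obtain x where x: "x \<in> W" "x \<notin> closed_nbrs G (S - {v})"
      using S by blast
    show ?thesis
    proof (cases "x = v")
      case True
      obtain y where y: "y \<in> nbrs G v" "y \<in> W" using assms(2) v by blast
      have "y \<notin> S"
        using x True y nbrs_irrefl[of v] nbrs_sym[of y v] by (auto simp: in_closed_nbrs_iff)
      then show ?thesis using y nbrs_sym by (auto simp: in_closed_nbrs_iff)
    next
      case False
      have "x \<in> closed_nbrs G S" using S x(1) by blast
      then have "x \<notin> S" "x \<in> nbrs G v"
        using x(2) False by (auto simp: in_closed_nbrs_iff)
      then show ?thesis using x(1) nbrs_sym by (auto simp: in_closed_nbrs_iff)
    qed
  qed (use v in \<open>auto simp: closed_nbrs_def\<close>)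
  then have "W - S \<in> ?D" by blast
  moreover have "card S + card (W - S) = card W"
  proof -
    have "S \<subseteq> W" using S by blast
    then show ?thesis
      using fin card_Diff_subset[of S W] card_mono[of W S] finite_subset[of S W] by simp
  qed
  \<comment> \<open>Both \<open>S\<close> and \<open>W - S\<close> dominate \<open>W\<close>, and
    the smaller of them has at most half of the elements.\<close>
  ultimately have "S \<subseteq> W \<and> W \<subseteq> closed_nbrs G S \<and> 2 * card S \<le> card W \<or>
      W - S \<subseteq> W \<and> W \<subseteq> closed_nbrs G (W - S) \<and> 2 * card (W - S) \<le> card W"
    using S by auto
  then show ?thesis by blast
qed

text \<open>Half of the n - q non-isolated vertices suffice to dominate these, and the q isolated
  ones are added: (n - q)/2 + q = (n + q)/2.\<close>

lemma power_dominating_small: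
  "\<exists>S. power_dominating G S \<and> 2 * card S \<le> card (pverts G) + card (isolated_verts G)"
proof -
  let ?I = "isolated_verts G" and ?W = "pverts G - isolated_verts G"
  have "nbrs G v \<inter> ?W \<noteq> {}" if "v \<in> ?W" for v
  proof -
    from that obtain y where y: "y \<in> nbrs G v" by (auto simp: isolated_verts_def)
    then have "y \<in> ?W" using nbrs_subset nbrs_sym by (auto simp: isolated_verts_def)
    with y show ?thesis by blast
  qed
  then obtain S where S: "S \<subseteq> ?W" "?W \<subseteq> closed_nbrs G S" "2 * card S \<le> card ?W"
    using dominating_half[of ?W] by blast
  have I: "?I \<subseteq> pverts G" by (auto simp: isolated_verts_def)
  have fin: "finite S" "finite ?I"
    using S(1) I pair_finite_verts by (auto intro: finite_subset)
  have "power_dominating G (S \<union> ?I)"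
    using S I by (intro power_dominating_if_dominating) (auto simp: closed_nbrs_def)
  moreover have "card ?W = card (pverts G) - card ?I"
    using fin I by (simp add: card_Diff_subset)
  moreover have "card (S \<union> ?I) \<le> card S + card ?I" by (rule card_Un_le)
  ultimately show ?thesis
    using S(3) card_isolated_verts_le by (intro exI[of _ "S \<union> ?I"]) auto
qed

text \<open>
  Remove a path \<open>u' u v\<close> together with the set \<open>I\<close> of vertices that this isolates, and dominate
  the rest by at most half of its vertices. Adding the right subset of the path leaves at most one
  vertex undominated and costs less than half of the removed vertices.
\<close>

lemma power_dominating_smaller:
  assumes "u' \<in> nbrs G u" "v \<in> nbrs G u" "u' \<noteq> v"
  shows "\<exists>S. power_dominating G S \<and> 2 * card S < card (pverts G) + card (isolated_verts G)"
proof -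
  let ?Z = "isolated_verts G"
  define X where "X = {u', u, v}"
  define I where "I = {w \<in> pverts G - X - ?Z. nbrs G w \<subseteq> X}"
  define R where "R = pverts G - X - ?Z - I"
  \<comment> \<open>\<open>J\<close> and \<open>K\<close> bound what is missed in \<open>I\<close>:
    choosing \<open>u\<close> leaves only vertices of \<open>J\<close> undominated, choosing
    \<open>u'\<close> and \<open>v\<close> only vertices of \<open>K\<close>.\<close>
  define J where "J = {w \<in> I. u \<notin> nbrs G w}"
  define K where "K = {w \<in> I. nbrs G w = {u}}"
  have ne: "u' \<noteq> u" "v \<noteq> u" using assms nbrs_irrefl by auto
  have uX: "u \<in> pverts G" using assms(1) nbrs_outside by fastforce
  then have XV: "X \<subseteq> pverts G" using assms nbrs_subset by (auto simp: X_def)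
  have XZ: "X \<inter> ?Z = {}"
    using assms nbrs_sym by (auto simp: X_def isolated_verts_def)
  have ZV: "?Z \<subseteq> pverts G" by (auto simp: isolated_verts_def)
  have IV: "I \<subseteq> pverts G" "I \<inter> X = {}" "I \<inter> ?Z = {}" by (auto simp: I_def)
  have JI: "J \<subseteq> I" "K \<subseteq> I" "J \<inter> K = {}" by (auto simp: J_def K_def)
  have fin: "finite (pverts G)" by (rule pair_finite_verts)
  have finI: "finite I" "finite J" "finite K" "finite ?Z" "finite X"
    using fin IV JI ZV XV by (meson finite_subset)+
  have cX: "card X = 3" using ne assms(3) by (simp add: X_def)
  \<comment> \<open>A vertex of \<open>R\<close> is not in \<open>I\<close>, so it has a neighbor
    outside \<open>X\<close>. That neighbor is adjacent to a vertex outside \<open>X\<close>, hence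
    not in \<open>I\<close> either. So \<open>dominating_half\<close> applies to
    \<open>R\<close>.\<close>
  have "nbrs G w \<inter> R \<noteq> {}" if w: "w \<in> R" for w
  proof -
    have "\<not> nbrs G w \<subseteq> X" using w by (auto simp: R_def I_def)
    then obtain y where y: "y \<in> nbrs G w" "y \<notin> X" by auto
    have "w \<notin> X" using w by (auto simp: R_def)
    then have "y \<in> R"
      using y nbrs_subset nbrs_sym by (auto simp: R_def I_def isolated_verts_def)
    then show ?thesis using y by blast
  qed
  then obtain S0 where S0: "S0 \<subseteq> R" "R \<subseteq> closed_nbrs G S0" "2 * card S0 \<le> card R"
    using dominating_half[of R] by (auto simp: R_def)
  have "card (X \<union> ?Z \<union> I) = 3 + card ?Z + card I"
    using finI cX XZ IV by (subst card_Un_disjoint; (subst card_Un_disjoint)?) auto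
  moreover have "card R = card (pverts G) - card (X \<union> ?Z \<union> I)"
    unfolding R_def using XV ZV IV finI
    by (subst card_Diff_subset[symmetric]) (auto intro!: arg_cong[of _ _ card])
  moreover have "card (X \<union> ?Z \<union> I) \<le> card (pverts G)"
    using XV ZV IV fin by (intro card_mono) auto
  ultimately have cR: "card R + 3 + card ?Z + card I = card (pverts G)" by linarith
  have JK: "card J + card K \<le> card I"
    using JI finI by (metis card_Un_disjoint card_mono le_sup_iff)
  \<comment> \<open>\<open>T\<close> is the chosen part of the path. Its cost is below half of
    \<open>card X + card I\<close>, which makes the total bound strict; the one vertex it may miss
    is forced by \<open>power_dominatingI\<close>.\<close>
  have main: ?thesis
    if T: "T \<subseteq> X" "2 * card T < 3 + card I" "X \<subseteq> closed_nbrs G T"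
      and one: "card (I - closed_nbrs G T) \<le> 1" for T
  proof -
    let ?S = "S0 \<union> T \<union> ?Z"
    have "card ?S \<le> card S0 + card T + card ?Z"
      using card_Un_le[of "S0 \<union> T" ?Z] card_Un_le[of S0 T] by linarith
    then have "2 * card ?S < card (pverts G) + card ?Z"
      using S0(3) T(2) cR by linarith
    moreover have sub: "?S \<subseteq> pverts G" using S0(1) T(1) XV ZV by (auto simp: R_def)
    have dom: "pverts G - (I - closed_nbrs G T) \<subseteq> closed_nbrs G ?S"
    proof
      fix w assume w: "w \<in> pverts G - (I - closed_nbrs G T)"
      then have "w \<in> R \<or> w \<in> X \<or> w \<in> ?Z \<or> w \<in> closed_nbrs G T" by (auto simp: R_def)
      then show "w \<in> closed_nbrs G ?S"
        using S0(2) T(3) by (auto simp: closed_nbrs_def)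
    qed
    have "power_dominating G ?S"
    proof (cases "I - closed_nbrs G T = {}")
      case True
      then have "pverts G \<subseteq> closed_nbrs G ?S" using dom by blast
      then show ?thesis by (rule power_dominating_if_dominating[OF sub])
    next
      case False
      then have "card (I - closed_nbrs G T) = 1"
        using one finI by (metis One_nat_def card_gt_0_iff finite_Diff le_antisym less_eq_Suc_le)
      then obtain w where w: "I - closed_nbrs G T = {w}" by (rule card_1_singletonE)
      then have "w \<in> I" by blast
      then have "nbrs G w \<noteq> {}" by (auto simp: I_def isolated_verts_def)
      then show ?thesis using dom sub power_dominatingI[of ?S w] w by simp
    qed
    ultimately show ?thesis by blast
  qed
  \<comment> \<open>The choices for \<open>T\<close> are \<open>{u}\<close>, \<open>{u', v}\<close>
    and \<open>X\<close>. Twice their sizes is 2, 4 and 6, and \<open>card I\<close> is at least 0,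
    2 and 4 respectively, so \<open>2 * card T < 3 + card I\<close> each time.\<close>
  consider "card J \<le> 1" | "2 \<le> card J" "card K \<le> 1" | "2 \<le> card J" "2 \<le> card K"
    by linarith
  then show ?thesis
  proof cases
    case 1
    have "I - closed_nbrs G {u} \<subseteq> J"
      using nbrs_sym by (auto simp: J_def closed_nbrs_def)
    then have "card (I - closed_nbrs G {u}) \<le> 1"
      using 1 finI card_mono by (meson le_trans)
    then show ?thesis
      using assms by (intro main[of "{u}"]) (auto simp: X_def closed_nbrs_def)
  next
    case 2
    have "w \<in> K" if "w \<in> I - closed_nbrs G {u', v}" for w
    proof -
      have "nbrs G w \<subseteq> {u}" using that nbrs_sym by (auto simp: I_def X_def closed_nbrs_def)
      moreover have "nbrs G w \<noteq> {}" using that by (auto simp: I_def isolated_verts_def)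
      ultimately show ?thesis using that by (auto simp: K_def)
    qed
    then have "I - closed_nbrs G {u', v} \<subseteq> K" by blast
    then have "card (I - closed_nbrs G {u', v}) \<le> 1"
      using 2 finI card_mono by (meson le_trans)
    then show ?thesis
      using assms 2 JK nbrs_sym by (intro main[of "{u', v}"]) (auto simp: X_def closed_nbrs_def)
  next
    case 3
    have "w \<in> closed_nbrs G X" if "w \<in> I" for w
      using that nbrs_sym by (auto simp: I_def isolated_verts_def closed_nbrs_def)
    then have "card (I - closed_nbrs G X) \<le> 1" by (simp add: Diff_eq_empty_iff[THEN iffD2] subsetI)
    moreover have "X \<subseteq> closed_nbrs G X" by (auto simp: closed_nbrs_def)
    ultimately show ?thesis
      using 3 JK cX by (intro main[of X]) auto
  qed
qed

end

subsection \<open>The power domination polynomial\<close>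

lemma sum_power_card_Pow:
  fixes x :: "'b :: comm_ring_1"
  assumes "finite B"
  shows "(\<Sum>T\<in>Pow B. x ^ card T) = (1 + x) ^ card B"
  using prod_add[OF assms, of "\<lambda>_. x" "\<lambda>_. 1"] by (simp add: add.commute)

text \<open>A hitting set of disjoint blocks is an independent choice of a nonempty subset of each
  block, and the nonempty subsets of \<open>B\<close> contribute
  \<open>(1 + x) ^ card B - 1\<close>.\<close>

lemma sum_power_card_hitting_sets:
  fixes x :: "'b :: comm_ring_1"
  assumes "finite \<B>" and "\<And>B. B \<in> \<B> \<Longrightarrow> finite B" and "disjoint \<B>"
  shows "(\<Sum>S | S \<subseteq> \<Union>\<B> \<and> (\<forall>B\<in>\<B>. S \<inter> B \<noteq> {}). x ^ card S) = (\<Prod>B\<in>\<B>. (1 + x) ^ card B - 1)"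
  using assms
proof (induction \<B> rule: finite_induct)
  case empty
  have "{S. S \<subseteq> \<Union>{} \<and> (\<forall>B\<in>{}. S \<inter> B \<noteq> {})} = {{} :: 'a set}" by auto
  then show ?case by simp
next
  case (insert B \<B>)
  let ?H = "{S. S \<subseteq> \<Union>\<B> \<and> (\<forall>B\<in>\<B>. S \<inter> B \<noteq> {})}" and ?P = "Pow B - {{}}"
  have finB: "finite B" and finU: "finite (\<Union>\<B>)" using insert by auto
  have disj: "B \<inter> \<Union>\<B> = {}"
    using insert.prems(2) insert.hyps(2) by (fastforce simp: pairwise_def disjnt_def)
  have "(\<Sum>S | S \<subseteq> \<Union>(insert B \<B>) \<and> (\<forall>B\<in>insert B \<B>. S \<inter> B \<noteq> {}). x ^ card S)
      = (\<Sum>(T, S)\<in>?P \<times> ?H. x ^ card T * x ^ card S)"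
  \<comment> \<open>Split a hitting set into its parts inside and outside \<open>B\<close>. As
    \<open>B\<close> is disjoint from the other blocks, removing \<open>B\<close> does not affect
    whether they are hit.\<close>
  proof (rule sum.reindex_bij_witness[of _ "\<lambda>(T, S). T \<union> S" "\<lambda>S. (S \<inter> B, S - B)"], goal_cases)
    case (1 S)
    then show ?case by auto
  next
    case (2 S)
    then have "(S - B) \<inter> C = S \<inter> C" if "C \<in> \<B>" for C using that disj by auto
    with 2 show ?case by auto
  next
    case (3 p)
    then show ?case using disj by auto
  next
    case (4 p)
    then obtain T S where p: "p = (T, S)" "T \<subseteq> B" "T \<noteq> {}" "S \<in> ?H" by auto
    then have "(T \<union> S) \<inter> C \<noteq> {}" if "C \<in> \<B>" for C using that by auto
    with p show ?case by auto
  next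
    case (5 S)
    then have "finite S" using finB finU by (auto intro: finite_subset)
    then have "card S = card (S \<inter> B) + card (S - B)"
      by (metis Diff_disjoint Int_Diff_Un card_Un_disjoint finite_Diff finite_Int inf_assoc inf_bot_right)
    then show ?case by (simp add: power_add)
  qed
  also have "\<dots> = (\<Sum>T\<in>?P. x ^ card T) * (\<Sum>S\<in>?H. x ^ card S)"
    by (simp add: sum_product sum.cartesian_product)
  also have "(\<Sum>T\<in>?P. x ^ card T) = (1 + x) ^ card B - 1"
    using finB by (simp add: sum_diff1 sum_power_card_Pow)
  also have "(\<Sum>S\<in>?H. x ^ card S) = (\<Prod>B\<in>\<B>. (1 + x) ^ card B - 1)"
    using insert.IH insert.prems by (simp add: pairwise_insert)
  finally show ?case using insert.hyps by simp
qed

text \<open>Phrasing the degree bound as uniqueness of neighbors lets it transfer along isomorphisms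
  by injectivity alone.\<close>

definition max_degree_le_1 :: "'a pair_pre_digraph \<Rightarrow> bool" where
  "max_degree_le_1 G \<longleftrightarrow> (\<forall>u v w. v \<in> nbrs G u \<longrightarrow> w \<in> nbrs G u \<longrightarrow> v = w)"

context pair_graph
begin

section \<open>Coefficients, values and degree of the polynomial\<close>

lemma finite_power_dominating_sets: "finite {S. power_dominating G S}"
  by (rule finite_subset[of _ "Pow (pverts G)"])
    (auto simp: power_dominating_def pair_finite_verts)

lemma power_dominating_card:
  assumes "power_dominating G S" "pverts G \<noteq> {}"
  shows "card S \<in> {1..card (pverts G)}"
proof -
  have S: "S \<subseteq> pverts G" using assms by (simp add: power_dominating_def)
  then have "finite S" using pair_finite_verts finite_subset by blast
  then have "card S \<noteq> 0" using power_dominating_nonempty assms by simp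
  then show ?thesis using card_mono[OF pair_finite_verts S] by simp
qed

text \<open>The defining sum runs from 1 to the order of the graph; outside this range there are no
  power dominating sets, so the formula holds for every \<open>i\<close>.\<close>

lemma coeff_power_domination_poly:
  assumes "pverts G \<noteq> {}"
  shows "coeff (power_domination_poly G) i = of_nat (num_power_dominating G i)"
proof (cases "i \<in> {1..card (pverts G)}")
  case True
  then show ?thesis by (simp add: power_domination_poly_def coeff_sum)
next
  case False
  then have none: "{S. power_dominating G S \<and> card S = i} = {}"
    using power_dominating_card[OF _ assms] by auto
  show ?thesis
    unfolding num_power_dominating_def none
    using False by (auto simp: power_domination_poly_def coeff_sum intro!: sum.neutral)
qed

lemma poly_power_domination_poly:
  assumes "pverts G \<noteq> {}"
  shows "poly (power_domination_poly G) x = (\<Sum>S | power_dominating G S. x ^ card S)"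
proof -
  have "(\<Sum>S | power_dominating G S. x ^ card S)
      = (\<Sum>i = 1..card (pverts G). \<Sum>S | S \<in> {S. power_dominating G S} \<and> card S = i. x ^ card S)"
    using finite_power_dominating_sets power_dominating_card[OF _ assms]
    by (intro sum.group[symmetric]) auto
  also have "\<dots> = (\<Sum>i = 1..card (pverts G). of_nat (num_power_dominating G i) * x ^ i)"
    by (intro sum.cong) (simp_all add: num_power_dominating_def)
  finally show ?thesis by (simp add: power_domination_poly_def poly_sum poly_monom)
qed

lemma num_power_dominating_card_verts: "num_power_dominating G (card (pverts G)) = 1"
proof -
  have "{S. power_dominating G S \<and> card S = card (pverts G)} = {pverts G}"
    using power_dominating_if_dominating[of "pverts G"] card_subset_eq[OF pair_finite_verts]
    by (auto simp: closed_nbrs_def) (auto simp: power_dominating_def)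
  then show ?thesis by (simp add: num_power_dominating_def)
qed

text \<open>Such a set omits a single vertex. An isolated vertex cannot be omitted; any other one
  can, by \<open>power_dominatingI\<close>.\<close>

lemma num_power_dominating_card_verts_minus_1:
  assumes "pverts G \<noteq> {}"
  shows "num_power_dominating G (card (pverts G) - 1) = card (pverts G) - card (isolated_verts G)"
proof -
  let ?V = "pverts G"
  have "{S. power_dominating G S \<and> card S = card ?V - 1} = (\<lambda>v. ?V - {v}) ` (?V - isolated_verts G)"
  proof (intro equalityI subsetI)
    fix S assume S: "S \<in> {S. power_dominating G S \<and> card S = card ?V - 1}"
    then have sub: "S \<subseteq> ?V" by (simp add: power_dominating_def)
    have "card (?V - S) = 1"
      using S sub pair_finite_verts assms card_gt_0_iff[of ?V]
      by (simp add: card_Diff_subset finite_subset)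
    then obtain v where v: "?V - S = {v}" by (rule card_1_singletonE)
    then have "S = ?V - {v}" using sub by blast
    moreover have "v \<in> ?V - isolated_verts G"
      using v S isolated_verts_subset_power_dominating[of S] by blast
    ultimately show "S \<in> (\<lambda>v. ?V - {v}) ` (?V - isolated_verts G)" by blast
  next
    fix S assume "S \<in> (\<lambda>v. ?V - {v}) ` (?V - isolated_verts G)"
    then obtain v where v: "S = ?V - {v}" "v \<in> ?V" "nbrs G v \<noteq> {}"
      by (auto simp: isolated_verts_def)
    have "power_dominating G S"
      using v by (intro power_dominatingI[of S v]) (auto simp: closed_nbrs_def)
    then show "S \<in> {S. power_dominating G S \<and> card S = card ?V - 1}"
      using v pair_finite_verts by simp
  qed
  moreover have "inj_on (\<lambda>v. ?V - {v}) (?V - isolated_verts G)" by (rule inj_onI) blast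
  moreover have "card (?V - isolated_verts G) = card ?V - card (isolated_verts G)"
    using pair_finite_verts
    by (intro card_Diff_subset) (auto simp: isolated_verts_def)
  ultimately show ?thesis by (simp add: num_power_dominating_def card_image)
qed

lemma degree_power_domination_poly:
  assumes "pverts G \<noteq> {}"
  shows "degree (power_domination_poly G) = card (pverts G)"
proof (rule antisym)
  show "degree (power_domination_poly G) \<le> card (pverts G)"
    unfolding power_domination_poly_def
    by (intro degree_sum_le) (auto intro: order.trans[OF degree_monom_le])
  show "card (pverts G) \<le> degree (power_domination_poly G)"
    by (rule le_degree)
      (simp add: coeff_power_domination_poly[OF assms] num_power_dominating_card_verts)
qed

section \<open>Graphs with all degrees at most 1\<close>

lemma power_dominating_iff_dominating:
  assumes "max_degree_le_1 G"
  shows "power_dominating G S \<longleftrightarrow> S \<subseteq> pverts G \<and> pverts G \<subseteq> closed_nbrs G S"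
proof
  assume pd: "power_dominating G S"
  \<comment> \<open>A colored vertex outside \<open>S\<close> got its color from a neighbor in
    \<open>S\<close>, which is its only neighbor. So no colored vertex has an uncolored neighbor,
    and forcing adds nothing.\<close>
  have "nbrs G u \<subseteq> closed_nbrs G S" if u: "u \<in> closed_nbrs G S" for u
  proof (cases "u \<in> S")
    case False
    then obtain s where "s \<in> S" "u \<in> nbrs G s"
      using u by (auto simp: in_closed_nbrs_iff)
    then have "s \<in> S" "s \<in> nbrs G u" using nbrs_sym by blast+
    then have "nbrs G u \<subseteq> S" using assms unfolding max_degree_le_1_def by blast
    then show ?thesis by (auto simp: in_closed_nbrs_iff)
  qed (auto simp: in_closed_nbrs_iff)
  then have "force_step G (closed_nbrs G S) = closed_nbrs G S"
    by (fastforce simp: force_step_def)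
  then show "S \<subseteq> pverts G \<and> pverts G \<subseteq> closed_nbrs G S"
    using pd forcing_closure_fixpoint[of G "closed_nbrs G S"] by (simp add: power_dominating_def)
qed (use power_dominating_if_dominating in blast)

text \<open>Closed neighborhoods partition the vertices into blocks of one or two elements, and a
  set dominates iff it hits every block. The polynomial is thus a product of factors x and x(x + 2),
  the latter occurring because there is an edge.\<close>

lemma power_domination_roots_max_degree_le_1:
  assumes "max_degree_le_1 G" and "parcs G \<noteq> {}"
  shows "power_domination_roots G = {0, -2}"
proof -
  let ?B = "\<lambda>v. insert v (nbrs G v)"
  define \<B> where "\<B> = ?B ` pverts G"
  obtain a b where ab: "(a, b) \<in> parcs G" using assms(2) by auto
  then have a: "a \<in> pverts G" "b \<in> nbrs G a" by (auto simp: nbrs_def dest: in_arcsD1)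
  then have ne: "pverts G \<noteq> {}" by blast
  have fin: "finite (nbrs G v)" for v using nbrs_subset pair_finite_verts finite_subset by blast
  have nbrs_eq: "nbrs G v = {w}" if "w \<in> nbrs G v" for v w
    using that assms(1) by (auto simp: max_degree_le_1_def)
  \<comment> \<open>The two ends of an edge have the same closed neighborhood, so blocks that meet
    coincide.\<close>
  have blk: "?B x = ?B u" if "x \<in> ?B u" for x u
    using that nbrs_eq[of x u] nbrs_eq[of u x] nbrs_sym[of x u] by auto
  have disj: "disjoint \<B>"
  proof (rule pairwiseI)
    fix B C assume "B \<in> \<B>" "C \<in> \<B>" "B \<noteq> C"
    then obtain u v where BC: "B = ?B u" "C = ?B v" by (auto simp: \<B>_def)
    show "disjnt B C"
    proof (rule ccontr)
      assume "\<not> disjnt B C"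
      then obtain x where "x \<in> ?B u" "x \<in> ?B v" using BC by (auto simp: disjnt_def)
      then have "?B u = ?B v" using blk by metis
      then show False using BC \<open>B \<noteq> C\<close> by simp
    qed
  qed
  have Un: "\<Union>\<B> = pverts G" using nbrs_subset by (auto simp: \<B>_def)
  have "power_dominating G S \<longleftrightarrow> S \<subseteq> \<Union>\<B> \<and> (\<forall>B\<in>\<B>. S \<inter> B \<noteq> {})" for S
    unfolding power_dominating_iff_dominating[OF assms(1)] Un
    using nbrs_sym by (fastforce simp: \<B>_def in_closed_nbrs_iff subset_iff)
  moreover have "finite \<B>" "\<And>B. B \<in> \<B> \<Longrightarrow> finite B"
    using fin pair_finite_verts by (auto simp: \<B>_def)
  ultimately have poly: "poly (power_domination_poly G) z = (\<Prod>B\<in>\<B>. (1 + z) ^ card B - 1)" for z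
    using sum_power_card_hitting_sets[of \<B> z] disj poly_power_domination_poly[OF ne, of z]
    by simp
  have card: "card (?B v) = (if nbrs G v = {} then 1 else 2)" for v
  proof (cases "nbrs G v = {}")
    case False
    then obtain w where w: "w \<in> nbrs G v" by auto
    then have "w \<noteq> v" using nbrs_irrefl by blast
    then show ?thesis using nbrs_eq[OF w] by simp
  qed simp
  have sq: "(1 + z) ^ 2 = 1 \<longleftrightarrow> z = 0 \<or> z = -2" for z :: complex
  proof -
    have "(1 + z) ^ 2 - 1 = z * (z + 2)" by (simp add: power2_eq_square algebra_simps)
    then have "(1 + z) ^ 2 = 1 \<longleftrightarrow> z * (z + 2) = 0" by (metis eq_iff_diff_eq_0)
    then show ?thesis by (simp add: eq_neg_iff_add_eq_0)
  qed
  have "poly (power_domination_poly G) z = 0 \<longleftrightarrow> z = 0 \<or> z = -2" for z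
  proof
    assume "poly (power_domination_poly G) z = 0"
    then obtain v where "(1 + z) ^ card (?B v) = 1"
      using pair_finite_verts by (auto simp: poly \<B>_def)
    then show "z = 0 \<or> z = -2" using card[of v] sq[of z] by (auto split: if_splits)
  next
    assume z: "z = 0 \<or> z = -2"
    have "card (?B a) = 2" using a card[of a] by auto
    then have "(1 + z) ^ card (?B a) - 1 = 0" using z sq by simp
    then show "poly (power_domination_poly G) z = 0"
      unfolding poly using a(1) pair_finite_verts by (intro prod_zero) (auto simp: \<B>_def)
  qed
  then show ?thesis by (auto simp: power_domination_roots_def)
qed

section \<open>Exactly two roots force all degrees to be at most 1\<close>

lemma two_power_domination_roots:
  assumes ne: "pverts G \<noteq> {}" and card2: "card (power_domination_roots G) = 2"
  shows "max_degree_le_1 G" and "parcs G \<noteq> {}"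
proof -
  define P where "P = power_domination_poly G"
  define n where "n = card (pverts G)"
  define q where "q = card (isolated_verts G)"
  have coeff: "coeff P i = of_nat (num_power_dominating G i)" for i
    using coeff_power_domination_poly[OF ne] by (simp add: P_def)
  have degP: "degree P = n" using degree_power_domination_poly[OF ne] by (simp add: P_def n_def)
  have lead: "lead_coeff P = 1"
    unfolding degP coeff n_def num_power_dominating_card_verts by simp
  have P0: "P \<noteq> 0" using lead by auto
  have "num_power_dominating G 0 = 0"
  proof -
    have "{S. power_dominating G S \<and> card S = 0} = {}"
      using power_dominating_card[OF _ ne] by fastforce
    then show ?thesis by (simp only: num_power_dominating_def card.empty)
  qed
  then have "poly P 0 = 0" by (simp add: poly_0_coeff_0 coeff)
  then have "0 \<in> power_domination_roots G" by (simp add: power_domination_roots_def P_def)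
  then obtain z where roots: "power_domination_roots G = {0, z}" and z0: "z \<noteq> 0"
    using card2 by (metis card_2_iff doubleton_eq_iff insertE singletonD)
  define a where "a = order 0 P"
  define m where "m = order z P"
  have rts: "{x. poly P x = 0} = {0, z}" using roots by (simp add: power_domination_roots_def P_def)
  have m: "m > 0" using rts P0 by (auto simp: m_def order_gt_0_iff)
  \<comment> \<open>A monic complex polynomial is the product of its linear factors. The s of the
    overview is \<open>- z\<close>, which is only a complex number so far.\<close>
  have P_eq: "P = monom 1 a * [:- z, 1:] ^ m"
    using complex_poly_decompose[of P] z0
    unfolding lead rts by (simp add: a_def m_def monom_altdef)
  have n: "n = a + m"
  proof -
    have "degree P = degree (monom 1 a :: complex poly) + degree ([:- z, 1:] ^ m)"
      unfolding P_eq by (rule degree_mult_eq) (auto simp: monom_eq_0_iff)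
    then show ?thesis using degP by (simp add: degree_monom_eq degree_linear_power)
  qed
  have coeff': "coeff P (a + i) = of_nat (m choose i) * (- z) ^ (m - i)" if "i \<le> m" for i
    unfolding P_eq using that by (simp add: coeff_monom_mult coeff_linear_poly_power)
  \<comment> \<open>Since \<open>m > 0\<close>, the index \<open>n - 1\<close> is
    \<open>a + (m - 1)\<close>, where the binomial coefficient is \<open>m\<close>.\<close>
  have "coeff P (n - 1) = of_nat m * (- z)"
    using coeff'[of "m - 1"] m n by (simp add: binomial_symmetric[of 1 m, simplified, symmetric] Suc_leI)
  then have sm: "of_nat (n - q) = of_nat m * (- z)"
    using num_power_dominating_card_verts_minus_1[OF ne] by (simp add: coeff n_def q_def)
  have na: "of_nat (num_power_dominating G a) = (- z) ^ m"
    using coeff'[of 0] coeff[of a] by simp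
  \<comment> \<open>The \<open>m\<close>-th power of \<open>n - q = m * (- z)\<close> contains
    \<open>(- z) ^ m\<close>, which counts the power dominating sets of size \<open>a\<close>. This
    is an equation between naturals; it yields \<open>m dvd n - q\<close>, so \<open>- z\<close> is
    a natural number.\<close>
  have "of_nat ((n - q) ^ m) = (of_nat (num_power_dominating G a * m ^ m) :: complex)"
    unfolding of_nat_mult of_nat_power sm na power_mult_distrib by (rule mult.commute)
  then have "(n - q) ^ m = num_power_dominating G a * m ^ m"
    using of_nat_eq_iff by blast
  then have "m ^ m dvd (n - q) ^ m" by simp
  then have "m dvd n - q" using m by (simp add: pow_divides_pow_iff)
  then obtain s where s: "n - q = m * s" by blast
  have "of_nat m * of_nat s = of_nat m * (- z)" using sm s by simp
  then have zs: "- z = of_nat s" using m mult_cancel_left[of "of_nat m" "of_nat s" "- z"] by simp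
  have s0: "s > 0" using zs z0 by (cases "s = 0") auto
  \<comment> \<open>The factor \<open>monom 1 a\<close> makes all coefficients below index
    \<open>a\<close> vanish.\<close>
  have min: "a \<le> card S" if "power_dominating G S" for S
  proof (rule ccontr)
    assume "\<not> a \<le> card S"
    then have "coeff P (card S) = 0" unfolding P_eq by (simp add: coeff_monom_mult)
    then have "card {T. power_dominating G T \<and> card T = card S} = 0"
      by (simp add: coeff num_power_dominating_def)
    moreover have "finite {T. power_dominating G T \<and> card T = card S}"
      using finite_power_dominating_sets by simp
    ultimately show False using that by auto
  qed
  have qn: "q \<le> n" unfolding q_def n_def by (rule card_isolated_verts_le)
  have "2 * a \<le> n + q"
    using power_dominating_small min unfolding n_def q_def by (meson le_trans mult_le_mono2)
  \<comment> \<open>Substitute \<open>a = n - m\<close> into \<open>2 * a \<le> n + q\<close> and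
    use \<open>n - q = m * s\<close>.\<close>
  then have "m * s \<le> m * 2" using s n qn by linarith
  then have "s \<le> 2" using m by simp
  have "s \<noteq> 1"
  proof
    assume "s = 1"
    \<comment> \<open>Now \<open>n - q = m = n - a\<close>. As the coefficient at \<open>a\<close>
      is nonzero, some power dominating set has \<open>q\<close> elements; containing all isolated
      vertices, it consists of exactly these, which leaves no other vertex and contradicts
      \<open>m > 0\<close>.\<close>
    then have aq: "a = q" using s n qn by simp
    have "num_power_dominating G a \<noteq> 0"
    proof
      assume "num_power_dominating G a = 0"
      then have "(- z) ^ m = 0" using na by simp
      then show False using z0 by simp
    qed
    then obtain S where S: "power_dominating G S" "card S = q"
      using aq by (auto simp: num_power_dominating_def card_eq_0_iff)
    then have "finite S" using pair_finite_verts by (auto simp: power_dominating_def intro: finite_subset)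
    then have "isolated_verts G = S"
      using S isolated_verts_subset_power_dominating[OF S(1)] by (simp add: card_subset_eq q_def)
    then have "n = q" using S power_dominating_isolated_verts by (simp add: n_def)
    then show False using aq n m by simp
  qed
  then have "s = 2" using \<open>s \<le> 2\<close> s0 by linarith
  \<comment> \<open>With equality here, \<open>power_dominating_smaller\<close> would give a set
    with fewer than \<open>a\<close> elements if some vertex had two neighbors.\<close>
  then have "2 * a = n + q" using s n qn by simp
  then show "max_degree_le_1 G"
    using power_dominating_smaller min unfolding max_degree_le_1_def n_def q_def
    by (metis leD mult_le_mono2)
  show "parcs G \<noteq> {}"
  proof
    assume "parcs G = {}"
    then have "isolated_verts G = pverts G" by (auto simp: isolated_verts_def nbrs_def)
    then show False using s s0 m by (simp add: n_def q_def)
  qed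
qed

end

subsection \<open>Isomorphism with a disjoint union of edges and isolated vertices\<close>

lemma wf_digraph_with_proj_iff:
  "wf_digraph (with_proj G) \<longleftrightarrow> parcs G \<subseteq> pverts G \<times> pverts G"
  by (fastforce simp: wf_digraph_def)

text \<open>A general digraph isomorphism also maps arcs, heads and tails. Here arcs are pairs with
  the projections as ends on both sides, so the vertex map determines everything.\<close>

lemma graph_isoE:
  assumes "G \<simeq>\<^sub>G H"
  obtains f where "parcs G \<subseteq> pverts G \<times> pverts G" and "inj_on f (pverts G)"
    and "pverts H = f ` pverts G" and "parcs H = map_prod f f ` parcs G"
proof -
  from assms obtain h where h: "pre_digraph.digraph_isomorphism (with_proj G) h"
    and H: "with_proj H = app_iso h (with_proj G)"
    by (auto simp: digraph_iso_def)
  have ends: "iso_tail h = fst" "iso_head h = snd" and vH: "pverts H = iso_verts h ` pverts G"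
    and aH: "parcs H = iso_arcs h ` parcs G"
    using H by (simp_all add: with_proj_def app_iso_def)
  have "iso_arcs h a = map_prod (iso_verts h) (iso_verts h) a" if "a \<in> parcs G" for a
    using h that by (cases a) (auto simp: pre_digraph.digraph_isomorphism_def ends prod_eq_iff)
  then have "parcs H = map_prod (iso_verts h) (iso_verts h) ` parcs G"
    unfolding aH by (intro image_cong) auto
  moreover have "parcs G \<subseteq> pverts G \<times> pverts G" "inj_on (iso_verts h) (pverts G)"
    using h by (simp_all add: pre_digraph.digraph_isomorphism_def wf_digraph_with_proj_iff)
  ultimately show ?thesis using vH by (intro that)
qed

lemma graph_isoI:
  assumes arcs: "parcs G \<subseteq> pverts G \<times> pverts G" and inj: "inj_on f (pverts G)"
    and "pverts H = f ` pverts G" and "parcs H = map_prod f f ` parcs G"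
  shows "G \<simeq>\<^sub>G H"
proof -
  let ?h = "\<lparr>iso_verts = f, iso_arcs = map_prod f f, iso_head = snd, iso_tail = fst\<rparr>"
  have "inj_on (map_prod f f) (parcs G)"
    using map_prod_inj_on[OF inj inj] arcs by (rule inj_on_subset)
  then have "pre_digraph.digraph_isomorphism (with_proj G) ?h"
    using assms by (auto simp: pre_digraph.digraph_isomorphism_def wf_digraph_with_proj_iff)
  moreover have "with_proj H = app_iso ?h (with_proj G)"
    using assms by (simp add: with_proj_def app_iso_def)
  ultimately show ?thesis unfolding digraph_iso_def by blast
qed

section \<open>Degrees and arcs under isomorphism and disjoint union\<close>

lemma max_degree_le_1_iso:
  assumes "G \<simeq>\<^sub>G H" and "max_degree_le_1 H"
  shows "max_degree_le_1 G"
proof -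
  from assms(1) obtain f where f: "parcs G \<subseteq> pverts G \<times> pverts G" "inj_on f (pverts G)"
    "parcs H = map_prod f f ` parcs G" by (rule graph_isoE)
  show ?thesis
    unfolding max_degree_le_1_def
  proof (intro allI impI)
    fix u v w assume vw: "v \<in> nbrs G u" "w \<in> nbrs G u"
    then have "f v \<in> nbrs H (f u)" "f w \<in> nbrs H (f u)"
      using f(3) by (force simp: nbrs_def)+
    then have "f v = f w" using assms(2) by (auto simp: max_degree_le_1_def)
    moreover have "v \<in> pverts G" "w \<in> pverts G" using vw f(1) by (auto simp: nbrs_def)
    ultimately show "v = w" using f(2) by (auto dest: inj_onD)
  qed
qed

lemma parcs_nonempty_iso: "G \<simeq>\<^sub>G H \<Longrightarrow> parcs G \<noteq> {} \<longleftrightarrow> parcs H \<noteq> {}"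
  by (elim graph_isoE) auto

lemma max_degree_le_1_path_graph_2: "max_degree_le_1 (path_graph 2)"
  by (auto simp: max_degree_le_1_def nbrs_def path_graph_def)

lemma parcs_path_graph_2: "parcs (path_graph 2) = {(0, 1), (1, 0)}"
  by (auto simp: path_graph_def)

lemma max_degree_le_1_sum:
  assumes "\<And>i. i \<in> A \<Longrightarrow> max_degree_le_1 (F i)"
  shows "max_degree_le_1 (graph_family_sum A F \<oplus>\<^sub>G edgeless_graph r)"
proof -
  let ?H = "graph_family_sum A F \<oplus>\<^sub>G edgeless_graph r"
  \<comment> \<open>Every arc of the sum stays inside one member of the family; the edgeless part
    has none.\<close>
  have arc: "\<exists>i x y. i \<in> A \<and> u = Inl (i, x) \<and> v = Inl (i, y) \<and> y \<in> nbrs (F i) x"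
    if "v \<in> nbrs ?H u" for u v
    using that by (auto simp: nbrs_def graph_sum_def graph_family_sum_def edgeless_graph_def)
  show ?thesis
    unfolding max_degree_le_1_def
  proof (intro allI impI)
    fix u v w assume "v \<in> nbrs ?H u" "w \<in> nbrs ?H u"
    then obtain i x y y' where "i \<in> A" "v = Inl (i, y)" "w = Inl (i, y')"
      "y \<in> nbrs (F i) x" "y' \<in> nbrs (F i) x"
      by (blast dest: arc)
    then show "v = w" using assms by (auto simp: max_degree_le_1_def)
  qed
qed

section \<open>Decomposition into single edges and isolated vertices\<close>

lemma (in pair_graph) iso_path_sum:
  assumes deg: "max_degree_le_1 G" and "parcs G \<noteq> {}"
  shows "\<exists>(k :: nat) r. k \<ge> 1 \<and> G \<simeq>\<^sub>G graph_family_sum {1..k} (\<lambda>_. path_graph 2) \<oplus>\<^sub>G edgeless_graph r"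
proof -
  \<comment> \<open>Edges are unordered pairs here, so that opposite arcs count once. By the degree
    bound they are pairwise disjoint; numbering them and the isolated vertices gives the
    isomorphism.\<close>
  define E where "E = {{x, y} | x y. (x, y) \<in> parcs G}"
  have nb: "v = w" if "(u, v) \<in> parcs G" "(u, w) \<in> parcs G" for u v w
    using deg that by (auto simp: max_degree_le_1_def nbrs_def)
  have E_eq: "e = e'" if "e \<in> E" "e' \<in> E" "x \<in> e" "x \<in> e'" for e e' x
  proof -
    have "\<exists>y. (x, y) \<in> parcs G \<and> e = {x, y}" if "e \<in> E" "x \<in> e" for e
      using that arcs_symmetric by (auto simp: E_def insert_commute)
    with that obtain y y' where "(x, y) \<in> parcs G" "e = {x, y}" "(x, y') \<in> parcs G" "e' = {x, y'}"
      by metis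
    then show ?thesis using nb by blast
  qed
  have "E \<subseteq> (\<lambda>(x, y). {x, y}) ` parcs G" by (force simp: E_def)
  then have finE: "finite E" using pair_finite_arcs finite_surj by blast
  have finZ: "finite (isolated_verts G)"
    using pair_finite_verts by (simp add: isolated_verts_def)
  define k where "k = card E"
  define r where "r = card (isolated_verts G)"
  have "E \<noteq> {}" using assms(2) by (auto simp: E_def)
  then have k: "k \<ge> 1" using finE by (simp add: k_def Suc_leI card_gt_0_iff)
  obtain b where b: "bij_betw b {1..k} E"
    using ex_bij_betw_nat_finite_1[OF finE] by (auto simp: k_def)
  obtain z where z: "bij_betw z {..<r} (isolated_verts G)"
    using ex_bij_betw_nat_finite[OF finZ] by (auto simp: r_def atLeast0LessThan)
  have "\<forall>i\<in>{1..k}. \<exists>x y. (x, y) \<in> parcs G \<and> b i = {x, y}"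
  proof
    fix i assume "i \<in> {1..k}"
    then have "b i \<in> E" using b by (rule bij_betwE[THEN bspec, rotated])
    then show "\<exists>x y. (x, y) \<in> parcs G \<and> b i = {x, y}" by (auto simp: E_def)
  qed
  \<comment> \<open>This fixes an arbitrary orientation of each numbered edge.\<close>
  then obtain p p' where p: "\<And>i. i \<in> {1..k} \<Longrightarrow> (p i, p' i) \<in> parcs G \<and> b i = {p i, p' i}"
    by metis
  have p_sym: "(p' i, p i) \<in> parcs G" if "i \<in> {1..k}" for i
    using p[OF that] arcs_symmetric by blast
  have pp: "p i \<noteq> p' i" if "i \<in> {1..k}" for i
    using p[OF that] pair_no_loops by fastforce
  \<comment> \<open>\<open>f\<close> goes from the model graph to \<open>G\<close>; on path vertices
    only \<open>j = 0\<close> and \<open>j = 1\<close> occur, so the else branch means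
    \<open>j = 1\<close>.\<close>
  define f where "f = case_sum (\<lambda>(i, j :: nat). if j = 0 then p i else p' i) z"
  define H where "H = graph_family_sum {1..k} (\<lambda>_. path_graph 2) \<oplus>\<^sub>G edgeless_graph r"
  have vH: "pverts H = ({1..k} \<times> {0, 1}) <+> {..<r}"
    by (auto simp: H_def graph_sum_def graph_family_sum_def path_graph_def edgeless_graph_def)
  have aH: "parcs H = (\<Union>i\<in>{1..k}. {(Inl (i, 0), Inl (i, 1)), (Inl (i, 1), Inl (i, 0))})"
    unfolding H_def graph_sum_def graph_family_sum_def parcs_path_graph_2
    by (auto simp: edgeless_graph_def)
  have b_inj: "i = i'" if "i \<in> {1..k}" "i' \<in> {1..k}" "x \<in> b i" "x \<in> b i'" for i i' x
  proof -
    have "b i = b i'" using E_eq[of "b i" "b i'" x] that bij_betwE[OF b] by blast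
    then show ?thesis using that bij_betw_imp_inj_on[OF b] by (blast dest: inj_onD)
  qed
  have f_in: "f (Inl (i, j)) \<in> b i" if "i \<in> {1..k}" for i j
    using p[OF that] by (simp add: f_def)
  have nonisol: "f (Inl c) \<notin> isolated_verts G" if "Inl c \<in> pverts H" for c
  proof -
    obtain i j where "c = (i, j)" "i \<in> {1..k}" using \<open>Inl c \<in> pverts H\<close> by (auto simp: vH)
    then show ?thesis using p[of i] p_sym[of i] by (auto simp: f_def isolated_verts_def nbrs_def)
  qed
  have z_in: "z j \<in> isolated_verts G" if "j < r" for j
    using z that by (auto dest: bij_betwE)
  have "inj_on f (pverts H)"
  proof (rule inj_onI)
    fix s t assume st: "s \<in> pverts H" "t \<in> pverts H" "f s = f t"
    show "s = t"
    proof (cases s; cases t)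
      fix c d assume cd: "s = Inl c" "t = Inl d"
      obtain i j i' j' where ij: "c = (i, j)" "d = (i', j')" by (cases c, cases d)
      have I: "i \<in> {1..k}" "i' \<in> {1..k}" "j \<in> {0, 1}" "j' \<in> {0, 1}"
        using st cd ij by (auto simp: vH)
      then have "i = i'" using b_inj[of i i' "f s"] f_in st(3) cd ij by metis
      then show "s = t" using st(3) cd ij I pp[OF I(1)] by (auto simp: f_def)
    next
      fix c d assume cd: "s = Inl c" "t = Inr d"
      then have "f t \<in> isolated_verts G" using st(1,2) z_in by (auto simp: vH f_def)
      moreover have "f s \<notin> isolated_verts G" using st cd nonisol by blast
      ultimately show "s = t" using st(3) by simp
    next
      fix c d assume cd: "s = Inr c" "t = Inl d"
      then have "f s \<in> isolated_verts G" using st(1,2) z_in by (auto simp: vH f_def)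
      moreover have "f t \<notin> isolated_verts G" using st cd nonisol by blast
      ultimately show "s = t" using st(3) by simp
    next
      fix c d assume cd: "s = Inr c" "t = Inr d"
      then show "s = t" using st z by (auto simp: vH f_def bij_betw_def dest: inj_onD)
    qed
  qed
  moreover have arcs: "parcs G = map_prod f f ` parcs H"
  proof
    show "map_prod f f ` parcs H \<subseteq> parcs G"
      using p p_sym by (auto simp: aH f_def)
    show "parcs G \<subseteq> map_prod f f ` parcs H"
    proof
      fix a assume a: "a \<in> parcs G"
      obtain x y where xy: "a = (x, y)" by (cases a)
      then have "{x, y} \<in> E" using a by (auto simp: E_def)
      then obtain i where i: "i \<in> {1..k}" "b i = {x, y}"
        using b by (auto simp: bij_betw_def image_iff)
      then have "x = p i \<and> y = p' i \<or> x = p' i \<and> y = p i"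
        using p[OF i(1)] by (auto simp: doubleton_eq_iff)
      then have "a = map_prod f f (Inl (i, 0), Inl (i, 1)) \<or> a = map_prod f f (Inl (i, 1), Inl (i, 0))"
        by (auto simp: xy f_def)
      moreover have "(Inl (i, 0), Inl (i, 1)) \<in> parcs H" "(Inl (i, 1), Inl (i, 0)) \<in> parcs H"
        unfolding aH using i(1) by blast+
      ultimately show "a \<in> map_prod f f ` parcs H" by blast
    qed
  qed
  moreover have "pverts G = f ` pverts H"
  proof
    show "f ` pverts H \<subseteq> pverts G"
    proof -
      have "p i \<in> pverts G" "p' i \<in> pverts G" if "i \<in> {1..k}" for i
        using p[OF that] in_arcsD1 in_arcsD2 by blast+
      moreover have "z j \<in> pverts G" if "j < r" for j
        using z_in[OF that] by (simp add: isolated_verts_def)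
      ultimately show ?thesis by (auto simp: vH f_def)
    qed
    show "pverts G \<subseteq> f ` pverts H"
    proof
      fix x assume x: "x \<in> pverts G"
      show "x \<in> f ` pverts H"
      proof (cases "x \<in> isolated_verts G")
        case True
        then obtain j where "j < r" "x = z j" using z by (auto simp: bij_betw_def)
        then have "x = f (Inr j)" "Inr j \<in> pverts H" by (auto simp: f_def vH)
        then show ?thesis by blast
      next
        case False
        then obtain y where "(x, y) \<in> parcs G" using x by (auto simp: isolated_verts_def nbrs_def)
        then obtain s t where "(s, t) \<in> parcs H" "x = f s" using arcs by auto
        moreover from this have "s \<in> pverts H" by (auto simp: aH vH)
        ultimately show ?thesis by blast
      qed
    qed
  qed
  moreover have wfH: "parcs H \<subseteq> pverts H \<times> pverts H" by (auto simp: aH vH)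
  \<comment> \<open>The isomorphism was built out of \<open>H\<close>; well-formedness of
    \<open>H\<close> allows reversing it.\<close>
  ultimately have "H \<simeq>\<^sub>G G" by (intro graph_isoI)
  moreover have "wf_digraph (with_proj H)" using wfH by (simp add: wf_digraph_with_proj_iff)
  ultimately have "G \<simeq>\<^sub>G H" by (rule digraph_iso_swap[rotated])
  with k show ?thesis unfolding H_def by blast
qed

theorem theorem32:
  fixes G :: "'a pair_pre_digraph"
  assumes "pair_graph G"
    and "pverts G \<noteq> {}"
  shows "(card (power_domination_roots G) = 2 \<longleftrightarrow>
           (\<exists>(k::nat) (r::nat) (F :: nat \<Rightarrow> nat pair_pre_digraph).
              k \<ge> 1 \<and> (\<forall>i\<in>{1..k}. F i \<simeq>\<^sub>G path_graph 2) \<and>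
              G \<simeq>\<^sub>G graph_family_sum {1..k} F \<oplus>\<^sub>G edgeless_graph r)) \<and>
         (card (power_domination_roots G) = 2 \<longrightarrow> power_domination_roots G = {0, -2})"
proof -
  interpret pair_graph G by (rule assms(1))
  have path_refl: "path_graph 2 \<simeq>\<^sub>G path_graph 2"
    by (rule graph_isoI[of _ id]) (auto simp: path_graph_def map_prod.id)
  have "\<exists>(k::nat) (r::nat) (F :: nat \<Rightarrow> nat pair_pre_digraph).
      k \<ge> 1 \<and> (\<forall>i\<in>{1..k}. F i \<simeq>\<^sub>G path_graph 2) \<and>
      G \<simeq>\<^sub>G graph_family_sum {1..k} F \<oplus>\<^sub>G edgeless_graph r"
    if "card (power_domination_roots G) = 2"
  proof -
    from iso_path_sum[OF two_power_domination_roots[OF assms(2) that]] obtain k r :: nat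
      where "k \<ge> 1" "G \<simeq>\<^sub>G graph_family_sum {1..k} (\<lambda>_. path_graph 2) \<oplus>\<^sub>G edgeless_graph r"
      by blast
    with path_refl show ?thesis
      by (intro exI[of _ k] exI[of _ r] exI[of _ "\<lambda>_. path_graph 2"]) simp
  qed
  moreover have "card (power_domination_roots G) = 2"
    if k: "k \<ge> 1" and F: "\<forall>i\<in>{1..k}. F i \<simeq>\<^sub>G path_graph 2"
      and iso: "G \<simeq>\<^sub>G graph_family_sum {1..k} F \<oplus>\<^sub>G edgeless_graph r"
    for k r :: nat and F :: "nat \<Rightarrow> nat pair_pre_digraph"
  proof -
    have "max_degree_le_1 (F i)" if "i \<in> {1..k}" for i
      using F that max_degree_le_1_iso max_degree_le_1_path_graph_2 by blast
    then have "max_degree_le_1 G"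
      using max_degree_le_1_iso[OF iso] max_degree_le_1_sum by blast
    \<comment> \<open>As \<open>k \<ge> 1\<close>, index 1 belongs to the family and provides an
      edge.\<close>
    moreover have "parcs (F 1) \<noteq> {}"
      using F k parcs_nonempty_iso[of "F 1" "path_graph 2"] by (simp add: parcs_path_graph_2)
    then have "parcs (graph_family_sum {1..k} F \<oplus>\<^sub>G edgeless_graph r) \<noteq> {}"
      using k by (fastforce simp: graph_sum_def graph_family_sum_def)
    then have "parcs G \<noteq> {}" using parcs_nonempty_iso[OF iso] by simp
    ultimately show ?thesis by (simp add: power_domination_roots_max_degree_le_1)
  qed
  moreover have "power_domination_roots G = {0, -2}" if "card (power_domination_roots G) = 2"
    using two_power_domination_roots[OF assms(2) that] by (rule power_domination_roots_max_degree_le_1)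
  ultimately show ?thesis by blast
qed

end
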